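(* Let $\mathfrak{Q}$ be the generalized quadratic number system with real parameters $\alpha_1,\alpha_2,\alpha_3,\beta_1,\beta_2,\lambda_1$ (see context), with associated symmetric matrix $\mathbf{M}_{\mathfrak{Q}}$ non-degenerate. Let $\mathbf{q}=q+x\mathbf{i}+y\mathbf{j}+z\mathbf{k}\in\mathfrak{Q}$ be a unit ellipsoid number (respectively, a unit timelike indefinite quadratic number). Then $$S_{\mathbf{q}}(\mathbf{p})=\mathbf{q}\,\mathbf{p}\,\overline{\mathbf{q}},$$ where $\mathbf{p}\in\mathfrak{Q}$ is an ellipsoid number (respectively, a unit timelike indefinite quadratic number), is a rotation transformation.
   Context: Given real numbers $\alpha_1,\alpha_2,\alpha_3,\beta_1,\beta_2,\lambda_1$, put $$A=\alpha_2^2+\alpha_3\beta_2,\quad B=\alpha_1^2-\lambda_1\alpha_3,\quad C=\beta_1^2+\lambda_1\beta_2,$$ $$D=-(\alpha_1\alpha_2+\alpha_3\beta_1),\quad E=\alpha_2\beta_1-\beta_2\alpha_1,\quad F=\alpha_1\beta_1+\lambda_1\alpha_2.$$ The generalized quadratic number system $\mathfrak{Q}$ is the 4-dimensional real vector space with basis $1,\mathbf{i},\mathbf{j},\mathbf{k}$, with the $\mathbb{R}$-bilinear product for which $1$ is the identity and $$\mathbf{i}^2=A,\quad \mathbf{j}^2=B,\quad \mathbf{k}^2=C,$$ $$\mathbf{ij}=D+\alpha_1\mathbf{i}+\alpha_2\mathbf{j}+\alpha_3\mathbf{k},\quad \mathbf{ji}=D-\alpha_1\mathbf{i}-\alpha_2\mathbf{j}-\alpha_3\mathbf{k},$$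 $$\mathbf{ik}=E+\beta_1\mathbf{i}+\beta_2\mathbf{j}-\alpha_2\mathbf{k},\quad \mathbf{ki}=E-\beta_1\mathbf{i}-\beta_2\mathbf{j}+\alpha_2\mathbf{k},$$ $$\mathbf{jk}=F+\lambda_1\mathbf{i}-\beta_1\mathbf{j}+\alpha_1\mathbf{k},\quad \mathbf{kj}=F-\lambda_1\mathbf{i}+\beta_1\mathbf{j}-\alpha_1\mathbf{k}.$$ This product is associative. The conjugate of $\mathbf{q}=q+x\mathbf{i}+y\mathbf{j}+z\mathbf{k}$ is $\overline{\mathbf{q}}=q-x\mathbf{i}-y\mathbf{j}-z\mathbf{k}$; $q$ is its scalar part and $x\mathbf{i}+y\mathbf{j}+z\mathbf{k}$, identified with $(x,y,z)\in\mathbb{R}^3$, is its vector part. The character of $\mathbf{q}$ is the real number $$\mathcal{C}(\mathbf{q})=\mathbf{q}\overline{\mathbf{q}}=\overline{\mathbf{q}}\mathbf{q}=q^2-Ax^2-By^2-Cz^2-2Dxy-2Exz-2Fyz,$$ the norm is $\|\mathbf{q}\|=\sqrt{|\mathcal{C}(\mathbf{q})|}$, and $\mathbf{q}$ is unit if $\|\mathbf{q}\|=1$. Let $$\mathbf{M}_{\mathfrak{Q}}=\begin{bmatrix} A & D & E \\ D & B & F \\ E & F & C \end{bmatrix}.$$ If $-\mathbf{M}_{\mathfrak{Q}}$ is positive definite (put $\Delta=-1$), the elements of $\mathfrak{Q}$ are called ellipsoid numbers. If $\mathbf{M}_{\mathfrak{Q}}$ is indefinite (put $\Delta=1$), the elements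 of $\mathfrak{Q}$ are called indefinite quadratic numbers, and such a number $\mathbf{q}$ is timelike if $\mathcal{C}(\mathbf{q})>0$. Put $\mathfrak{M}_{\mathfrak{Q}}=\Delta\mathbf{M}_{\mathfrak{Q}}$ and $\langle\mathbf{u},\mathbf{v}\rangle_{\mathfrak{Q}}=\mathbf{u}^T\mathfrak{M}_{\mathfrak{Q}}\mathbf{v}$ for $\mathbf{u},\mathbf{v}\in\mathbb{R}^3$. That $S_{\mathbf q}$ is a rotation transformation means: there is a linear map $R:\mathbb{R}^3\to\mathbb{R}^3$, not depending on $\mathbf{p}$, with $\langle R\mathbf{u},R\mathbf{v}\rangle_{\mathfrak{Q}}=\langle\mathbf{u},\mathbf{v}\rangle_{\mathfrak{Q}}$ for all $\mathbf{u},\mathbf{v}\in\mathbb{R}^3$ and $\det R=1$, such that for every $\mathbf{p}$ as in the claim, with scalar part $p_0$ and vector part $\mathbf{v}_{\mathbf{p}}$, the number $S_{\mathbf{q}}(\mathbf{p})$ has scalar part $p_0$ and vector part $R\mathbf{v}_{\mathbf{p}}$. *)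

theory Defs
  imports "HOL-Analysis.Analysis"
begin

record gq_params =
  alpha1 :: real
  alpha2 :: real
  alpha3 :: real
  beta1 :: real
  beta2 :: real
  lambda1 :: real

definition gq_A :: "gq_params \<Rightarrow> real" where
  "gq_A P = (alpha2 P)\<^sup>2 + alpha3 P * beta2 P"
definition gq_B :: "gq_params \<Rightarrow> real" where
  "gq_B P = (alpha1 P)\<^sup>2 - lambda1 P * alpha3 P"
definition gq_C :: "gq_params \<Rightarrow> real" where
  "gq_C P = (beta1 P)\<^sup>2 + lambda1 P * beta2 P"
definition gq_D :: "gq_params \<Rightarrow> real" where
  "gq_D P = - (alpha1 P * alpha2 P + alpha3 P * beta1 P)"
definition gq_E :: "gq_params \<Rightarrow> real" where
  "gq_E P = alpha2 P * beta1 P - beta2 P * alpha1 P"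
definition gq_F :: "gq_params \<Rightarrow> real" where
  "gq_F P = alpha1 P * beta1 P + lambda1 P * alpha2 P"

text \<open>The number \<open>q + x i + y j + z k\<close> is the pair of its scalar part \<open>q\<close> and its vector part
  \<open>(x, y, z)\<close>. Only the vector space structure of the type is used; the product depends on the
  parameters and is given by the table of the products of the basis elements \<open>i\<close>, \<open>j\<close>, \<open>k\<close>
  (row \<open>m\<close>, column \<open>n\<close>: the product of the \<open>m\<close>-th and the \<open>n\<close>-th), extended bilinearly.\<close>

type_synonym gq = "real \<times> (real ^ 3)"

definition gq_table :: "gq_params \<Rightarrow> (gq ^ 3) ^ 3" where
  "gq_table P = vector [
     vector [(gq_A P, 0),
             (gq_D P, vector [alpha1 P, alpha2 P, alpha3 P]),
             (gq_E P, vector [beta1 P, beta2 P, - alpha2 P])],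
     vector [(gq_D P, vector [- alpha1 P, - alpha2 P, - alpha3 P]),
             (gq_B P, 0),
             (gq_F P, vector [lambda1 P, - beta1 P, alpha1 P])],
     vector [(gq_E P, vector [- beta1 P, - beta2 P, alpha2 P]),
             (gq_F P, vector [- lambda1 P, beta1 P, - alpha1 P]),
             (gq_C P, 0)]]"

definition gq_mult :: "gq_params \<Rightarrow> gq \<Rightarrow> gq \<Rightarrow> gq" where
  "gq_mult P p q =
     (fst p * fst q, fst p *\<^sub>R snd q + fst q *\<^sub>R snd p)
     + (\<Sum>m\<in>UNIV. \<Sum>n\<in>UNIV. (snd p $ m * snd q $ n) *\<^sub>R (gq_table P $ m $ n))"

definition gq_conj :: "gq \<Rightarrow> gq" where
  "gq_conj q = (fst q, - snd q)"

text \<open>The product \<open>q \<cdot> conj q\<close> is a real number; see the lemma \<open>gq_mult_conj\<close> below.\<close>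

definition gq_character :: "gq_params \<Rightarrow> gq \<Rightarrow> real" where
  "gq_character P q = fst (gq_mult P q (gq_conj q))"

definition gq_norm :: "gq_params \<Rightarrow> gq \<Rightarrow> real" where
  "gq_norm P q = sqrt \<bar>gq_character P q\<bar>"

definition gq_unit :: "gq_params \<Rightarrow> gq \<Rightarrow> bool" where
  "gq_unit P q \<longleftrightarrow> gq_norm P q = 1"

definition gq_timelike :: "gq_params \<Rightarrow> gq \<Rightarrow> bool" where
  "gq_timelike P q \<longleftrightarrow> gq_character P q > 0"

definition gq_matrix :: "gq_params \<Rightarrow> real ^ 3 ^ 3" where
  "gq_matrix P = vector [vector [gq_A P, gq_D P, gq_E P],
                         vector [gq_D P, gq_B P, gq_F P],
                         vector [gq_E P, gq_F P, gq_C P]]"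

definition positive_definite_matrix :: "real ^ 'n ^ 'n \<Rightarrow> bool" where
  "positive_definite_matrix M \<longleftrightarrow> transpose M = M \<and> (\<forall>v. v \<noteq> 0 \<longrightarrow> v \<bullet> (M *v v) > 0)"

definition indefinite_matrix :: "real ^ 'n ^ 'n \<Rightarrow> bool" where
  "indefinite_matrix M \<longleftrightarrow>
     transpose M = M \<and> (\<exists>u. u \<bullet> (M *v u) > 0) \<and> (\<exists>v. v \<bullet> (M *v v) < 0)"

definition gq_ellipsoid :: "gq_params \<Rightarrow> bool" where
  "gq_ellipsoid P \<longleftrightarrow> positive_definite_matrix (- gq_matrix P)"

definition gq_indefinite :: "gq_params \<Rightarrow> bool" where
  "gq_indefinite P \<longleftrightarrow> indefinite_matrix (gq_matrix P)"

text \<open>The sign \<open>\<Delta>\<close> is only meaningful if \<open>gq_ellipsoid P\<close> or \<open>gq_indefinite P\<close> holds.\<close>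

definition gq_Delta :: "gq_params \<Rightarrow> real" where
  "gq_Delta P = (if gq_ellipsoid P then - 1 else 1)"

definition gq_inner :: "gq_params \<Rightarrow> real ^ 3 \<Rightarrow> real ^ 3 \<Rightarrow> real" where
  "gq_inner P u v = u \<bullet> ((gq_Delta P *\<^sub>R gq_matrix P) *v v)"

definition gq_sandwich :: "gq_params \<Rightarrow> gq \<Rightarrow> gq \<Rightarrow> gq" where
  "gq_sandwich P q p = gq_mult P (gq_mult P q p) (gq_conj q)"

text \<open>\<open>S\<close> acts on the numbers in \<open>X\<close> as a rotation of the vector part, for the scalar product
  associated with \<open>P\<close>.\<close>

definition gq_rotation_on :: "gq_params \<Rightarrow> gq set \<Rightarrow> (gq \<Rightarrow> gq) \<Rightarrow> bool" where
  "gq_rotation_on P X S \<longleftrightarrow>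
     (\<exists>R. linear R \<and> (\<forall>u v. gq_inner P (R u) (R v) = gq_inner P u v) \<and> det (matrix R) = 1 \<and>
          (\<forall>p\<in>X. fst (S p) = fst p \<and> snd (S p) = R (snd p)))"

lemmas gq_coeff_defs = gq_A_def gq_B_def gq_C_def gq_D_def gq_E_def gq_F_def

lemma gq_mult_components:
  "gq_mult P (a, u) (b, v) =
     (a * b + u \<bullet> (gq_matrix P *v v),
      a *\<^sub>R v + b *\<^sub>R u +
      (u$1 * v$2 - u$2 * v$1) *\<^sub>R vector [alpha1 P, alpha2 P, alpha3 P] +
      (u$1 * v$3 - u$3 * v$1) *\<^sub>R vector [beta1 P, beta2 P, - alpha2 P] +
      (u$2 * v$3 - u$3 * v$2) *\<^sub>R vector [lambda1 P, - beta1 P, alpha1 P])"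
  by (simp add: gq_mult_def gq_table_def gq_matrix_def sum_3 vector_3 inner_vec_def
      matrix_vector_mult_def vec_eq_iff forall_3 prod_eq_iff algebra_simps)

lemma gq_mult_one:
  "gq_mult P (1, 0) p = p" "gq_mult P p (1, 0) = p"
  by (cases p; simp add: gq_mult_components)+

lemma gq_mult_assoc: "gq_mult P (gq_mult P p q) r = gq_mult P p (gq_mult P q r)"
  by (cases p; cases q; cases r)
     (simp add: gq_mult_components gq_matrix_def gq_coeff_defs sum_3 vector_3 inner_vec_def
      matrix_vector_mult_def vec_eq_iff forall_3 algebra_simps power2_eq_square)

lemma gq_mult_conj:
  "gq_mult P q (gq_conj q) = (gq_character P q, 0)"
  "gq_mult P (gq_conj q) q = (gq_character P q, 0)"
  by (cases q; simp add: gq_character_def gq_conj_def gq_mult_components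
      inner_vec_def matrix_vector_mult_def sum_3 vec_eq_iff forall_3 algebra_simps)+

lemma gq_character_eq:
  "gq_character P (q, vector [x, y, z]) =
     q\<^sup>2 - gq_A P * x\<^sup>2 - gq_B P * y\<^sup>2 - gq_C P * z\<^sup>2
     - 2 * gq_D P * x * y - 2 * gq_E P * x * z - 2 * gq_F P * y * z"
  by (simp add: gq_character_def gq_conj_def gq_mult_components gq_matrix_def inner_vec_def
      matrix_vector_mult_def sum_3 vector_3 algebra_simps power2_eq_square)

end

theory Submission
  imports Defs
begin

text \<open>Write \<open>q = a + v\<close> and \<open>c = \<C>(q)\<close>, and let \<open>K\<close> be the linear map sending a vector \<open>u\<close> to the
  vector part of \<open>v u\<close>. Then \<open>q u q\<^sup>*\<close> has vector part \<open>R u\<close> with \<open>R = c + 2 a K + 2 K\<^sup>2\<close>. The scalar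
  part of a product does not depend on the order of the factors and \<open>\<langle>u, w\<rangle>\<close> is, up to sign, the
  scalar part of \<open>u w\<close>, so \<open>R\<close> multiplies the bilinear form by \<open>c\<^sup>2\<close>. Finally \<open>K\<close> has the eigenvalues
  \<open>0\<close> and \<open>\<plusminus>\<surd>N\<close> with \<open>N = v\<^sup>2 = a\<^sup>2 - c\<close>, so \<open>R\<close> has the eigenvalues \<open>c\<close> and \<open>(a \<plusminus> \<surd>N)\<^sup>2\<close>, whose
  product is \<open>c\<^sup>3\<close>. This gives a rotation as soon as \<open>c = 1\<close>.\<close>

definition gq_form :: "gq_params \<Rightarrow> real ^ 3 \<Rightarrow> real ^ 3 \<Rightarrow> real" where
  "gq_form P u v = u \<bullet> (gq_matrix P *v v)"

text \<open>The columns are the vector parts of \<open>v i\<close>, \<open>v j\<close>,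
  \<open>v k\<close>; this is the matrix of \<open>K\<close>.\<close>

definition gq_cross_matrix :: "gq_params \<Rightarrow> real ^ 3 \<Rightarrow> real ^ 3 ^ 3" where
  "gq_cross_matrix P v = vector [
     vector [- v$2 * alpha1 P - v$3 * beta1 P, v$1 * alpha1 P - v$3 * lambda1 P,
             v$1 * beta1 P + v$2 * lambda1 P],
     vector [- v$2 * alpha2 P - v$3 * beta2 P, v$1 * alpha2 P + v$3 * beta1 P,
             v$1 * beta2 P - v$2 * beta1 P],
     vector [- v$2 * alpha3 P + v$3 * alpha2 P, v$1 * alpha3 P - v$3 * alpha1 P,
             - v$1 * alpha2 P + v$2 * alpha1 P]]"

definition gq_rotation_matrix :: "gq_params \<Rightarrow> gq \<Rightarrow> real ^ 3 ^ 3" where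
  "gq_rotation_matrix P q = (let K = gq_cross_matrix P (snd q) in
     mat (gq_character P q) + (2 * fst q) *\<^sub>R K + 2 *\<^sub>R (K ** K))"

lemma gq_mult_pair:
  "gq_mult P (a, u) (b, v) =
     (a * b + gq_form P u v, a *\<^sub>R v + b *\<^sub>R u + gq_cross_matrix P u *v v)"
  by (simp add: gq_mult_components gq_form_def gq_cross_matrix_def sum_3 vector_3
      matrix_vector_mult_def vec_eq_iff forall_3 algebra_simps)

lemma gq_form_commute: "gq_form P u v = gq_form P v u"
  by (simp add: gq_form_def gq_matrix_def inner_vec_def matrix_vector_mult_def sum_3 algebra_simps)

lemma gq_form_linear_simps:
  "gq_form P (u + v) w = gq_form P u w + gq_form P v w"
  "gq_form P (c *\<^sub>R u) w = c * gq_form P u w"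
  "gq_form P (- u) w = - gq_form P u w"
  "gq_form P u (v + w) = gq_form P u v + gq_form P u w"
  "gq_form P u (c *\<^sub>R w) = c * gq_form P u w"
  "gq_form P u (- w) = - gq_form P u w"
  by (simp_all add: gq_form_def inner_vec_def matrix_vector_mult_def sum_3 algebra_simps)

lemma gq_cross_linear_simps:
  "gq_cross_matrix P (u + v) *v w = gq_cross_matrix P u *v w + gq_cross_matrix P v *v w"
  "gq_cross_matrix P (c *\<^sub>R u) *v w = c *\<^sub>R (gq_cross_matrix P u *v w)"
  "gq_cross_matrix P u *v (v + w) = gq_cross_matrix P u *v v + gq_cross_matrix P u *v w"
  "gq_cross_matrix P u *v (c *\<^sub>R w) = c *\<^sub>R (gq_cross_matrix P u *v w)"
  "gq_cross_matrix P u *v (- w) = - (gq_cross_matrix P u *v w)"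
  by (simp_all add: gq_cross_matrix_def sum_3 matrix_vector_mult_def vec_eq_iff forall_3
      algebra_simps)

lemma gq_cross_swap: "gq_cross_matrix P u *v v = - (gq_cross_matrix P v *v u)"
  by (simp add: gq_cross_matrix_def sum_3 matrix_vector_mult_def vec_eq_iff forall_3
      algebra_simps)

lemma gq_cross_self [simp]: "gq_cross_matrix P v *v v = 0"
  by (simp add: gq_cross_matrix_def sum_3 matrix_vector_mult_def vec_eq_iff forall_3
      algebra_simps)

text \<open>Both are read off from associativity, \<open>(v v) u = v (v u)\<close>: since
  \<open>v v\<close> is a real number, the scalar parts give the first identity and the vector parts
  the second.\<close>

lemma
  shows gq_form_cross: "gq_form P v (gq_cross_matrix P v *v u) = 0"
    and gq_cross_cross: "gq_cross_matrix P v *v (gq_cross_matrix P v *v u) =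
      gq_form P v v *\<^sub>R u - gq_form P v u *\<^sub>R v"
proof -
  have "gq_mult P (gq_mult P (0, v) (0, v)) (0, u) = gq_mult P (0, v) (gq_mult P (0, v) (0, u))"
    by (rule gq_mult_assoc)
  moreover have "gq_cross_matrix P 0 = 0"
    by (simp add: gq_cross_matrix_def vec_eq_iff forall_3)
  ultimately show "gq_form P v (gq_cross_matrix P v *v u) = 0"
    and "gq_cross_matrix P v *v (gq_cross_matrix P v *v u) =
      gq_form P v v *\<^sub>R u - gq_form P v u *\<^sub>R v"
    by (simp_all add: gq_mult_pair gq_form_def algebra_simps)
qed

lemma gq_character_pair: "gq_character P (a, v) = a\<^sup>2 - gq_form P v v"
  by (simp add: gq_character_def gq_conj_def gq_mult_pair gq_form_linear_simps power2_eq_square)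

lemma gq_sandwich_pair:
  "gq_sandwich P q (b, u) = (gq_character P q * b, gq_rotation_matrix P q *v u)"
proof (cases q)
  case (Pair a v)
  have mat: "mat c *v u = c *\<^sub>R u" for c
    by (simp add: mat_def matrix_vector_mult_def vec_eq_iff forall_3 sum_3)
  \<comment> \<open>Anticommutativity turns right multiplication by \<open>v\<close> into powers of
    \<open>K\<close>. The remaining multiple of \<open>v\<close> is then rewritten by
    \<open>gq_cross_cross\<close>, which yields the second \<open>K\<^sup>2\<close>.\<close>
  have K: "gq_cross_matrix P (gq_cross_matrix P v *v u) *v v =
      - (gq_cross_matrix P v *v (gq_cross_matrix P v *v u))"
    by (rule gq_cross_swap)
  have "gq_rotation_matrix P q *v u =
      gq_character P q *\<^sub>R u + (2 * a) *\<^sub>R (gq_cross_matrix P v *v u) +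
      2 *\<^sub>R (gq_cross_matrix P v *v (gq_cross_matrix P v *v u))"
    by (simp add: gq_rotation_matrix_def Pair Let_def matrix_vector_mult_add_rdistrib
        scaleR_matrix_vector_assoc [symmetric] matrix_vector_mul_assoc mat)
  then show ?thesis
    using gq_form_cross [of P v u] gq_cross_swap [of P u v]
    by (simp add: gq_sandwich_def Pair gq_conj_def gq_mult_pair gq_form_linear_simps
        gq_cross_linear_simps gq_character_pair K gq_cross_cross gq_form_commute [of P u v]
        gq_form_commute [of P "gq_cross_matrix P v *v u" v] vec_eq_iff
        algebra_simps power2_eq_square)
qed

lemma fst_gq_mult_commute: "fst (gq_mult P p q) = fst (gq_mult P q p)"
  by (cases p; cases q) (simp add: gq_mult_pair gq_form_commute)

lemma gq_form_rotation:
  "gq_form P (gq_rotation_matrix P q *v u) (gq_rotation_matrix P q *v v) =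
     (gq_character P q)\<^sup>2 * gq_form P u v"
proof -
  let ?c = "gq_character P q" and ?S = "gq_sandwich P q"
  have scalar: "gq_mult P (b, 0) p = b *\<^sub>R p" for b p
    by (cases p) (simp add: gq_mult_components)
  have scaleR_right: "gq_mult P p (b *\<^sub>R r) = b *\<^sub>R gq_mult P p r" for b p r
    by (cases p; cases r) (simp add: gq_mult_pair gq_form_linear_simps gq_cross_linear_simps
        algebra_simps)
  have "gq_form P (gq_rotation_matrix P q *v u) (gq_rotation_matrix P q *v v) =
      fst (gq_mult P (?S (0, u)) (?S (0, v)))"
    by (simp add: gq_sandwich_pair gq_mult_pair)
  \<comment> \<open>The inner \<open>gq_conj q\<close> and \<open>q\<close> meet and collapse to the
    real number \<open>?c\<close>. The sandwich of the product \<open>u v\<close> contributes the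
    second factor \<open>?c\<close> to the scalar part.\<close>
  also have "gq_mult P (?S (0, u)) (?S (0, v)) =
      gq_mult P q (gq_mult P (0, u) (gq_mult P (gq_mult P (gq_conj q) q)
        (gq_mult P (0, v) (gq_conj q))))"
    by (simp only: gq_sandwich_def gq_mult_assoc)
  also have "\<dots> = ?c *\<^sub>R ?S (gq_mult P (0, u) (0, v))"
    by (simp add: gq_mult_conj scalar scaleR_right gq_sandwich_def gq_mult_assoc)
  finally show ?thesis
    by (simp add: gq_mult_pair gq_sandwich_pair power2_eq_square)
qed

text \<open>The last assumption concerns the sum of the principal 2 by 2 minors, so \<open>K\<close>
  has characteristic polynomial \<open>t^3 + (c - a^2) t\<close>. Its roots may be complex, hence a
  polynomial identity in the entries replaces the eigenvalue argument.\<close>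

lemma det_quadratic_traceless_3:
  fixes K :: "real ^ 3 ^ 3"
  assumes "K$1$1 + K$2$2 + K$3$3 = 0" and "det K = 0"
    and c: "K$1$1 * K$2$2 - K$1$2 * K$2$1 + K$1$1 * K$3$3 - K$1$3 * K$3$1
         + K$2$2 * K$3$3 - K$2$3 * K$3$2 = c - a\<^sup>2"
  shows "det (mat c + (2 * a) *\<^sub>R K + 2 *\<^sub>R (K ** K)) = c ^ 3"
proof -
  have K33: "K$3$3 = - K$1$1 - K$2$2"
    using assms(1) by linarith
  have c': "c = a\<^sup>2 + (K$1$1 * K$2$2 - K$1$2 * K$2$1 + K$1$1 * K$3$3 - K$1$3 * K$3$1
         + K$2$2 * K$3$3 - K$2$3 * K$3$2)"
    using c by linarith
  \<comment> \<open>By the resultant of the characteristic polynomial of \<open>K\<close> and \<open>2 t\<^sup>2 + 2 a t + c\<close>.\<close>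
  have "det (mat c + (2 * a) *\<^sub>R K + 2 *\<^sub>R (K ** K)) =
      c ^ 3 - 4 * a * c * det K + 8 * (det K)\<^sup>2"
    unfolding c' by (simp add: det_3 mat_def matrix_matrix_mult_def sum_3 K33) algebra
  with assms(2) show ?thesis
    by simp
qed

lemma det_gq_rotation_matrix: "det (gq_rotation_matrix P q) = gq_character P q ^ 3"
proof (cases q)
  case (Pair a v)
  let ?K = "gq_cross_matrix P v"
  have tr: "?K$1$1 + ?K$2$2 + ?K$3$3 = 0"
    by (simp add: gq_cross_matrix_def algebra_simps)
  have det: "det ?K = 0"
    by (simp add: gq_cross_matrix_def det_3 algebra_simps)
  \<comment> \<open>Both sides equal \<open>- gq_form P v v\<close>, by the formulas for the entries
    of \<open>gq_matrix P\<close>.\<close>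
  have "?K$1$1 * ?K$2$2 - ?K$1$2 * ?K$2$1 + ?K$1$1 * ?K$3$3 - ?K$1$3 * ?K$3$1
         + ?K$2$2 * ?K$3$3 - ?K$2$3 * ?K$3$2 = gq_character P q - a\<^sup>2"
    by (simp add: Pair gq_character_pair gq_form_def gq_matrix_def gq_coeff_defs inner_vec_def
        matrix_vector_mult_def sum_3 gq_cross_matrix_def algebra_simps power2_eq_square)
  from det_quadratic_traceless_3 [OF tr det this] show ?thesis
    by (simp add: gq_rotation_matrix_def Pair Let_def)
qed

lemma gq_rotation_on_sandwich:
  assumes "gq_character P q = 1"
  shows "gq_rotation_on P X (gq_sandwich P q)"
proof -
  let ?R = "gq_rotation_matrix P q"
  \<comment> \<open>The sign factors out, so one argument serves both kinds of numbers.\<close>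
  have inner: "gq_inner P u v = gq_Delta P * gq_form P u v" for u v
    by (simp add: gq_inner_def gq_form_def scaleR_matrix_vector_assoc [symmetric])
  have "gq_inner P (?R *v u) (?R *v v) = gq_inner P u v" for u v
    by (simp add: inner gq_form_rotation assms)
  moreover have "fst (gq_sandwich P q p) = fst p" "snd (gq_sandwich P q p) = ?R *v snd p" for p
    using gq_sandwich_pair [of P q "fst p" "snd p"] assms by simp_all
  ultimately show ?thesis
    unfolding gq_rotation_on_def using assms
    by (intro exI [of _ "(*v) ?R"]) (simp add: det_gq_rotation_matrix)
qed

lemma gq_character_nonneg_if_ellipsoid:
  assumes "gq_ellipsoid P"
  shows "gq_character P q \<ge> 0"
proof (cases q)
  case (Pair a v)
  have "- gq_matrix P *v v = - (gq_matrix P *v v)"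
    by (simp add: matrix_vector_mult_def vec_eq_iff sum_negf)
  then have "gq_form P v v \<le> 0"
    using assms unfolding gq_ellipsoid_def positive_definite_matrix_def gq_form_def
    by (cases "v = 0") (force dest: spec [of _ v])+
  then show ?thesis
    using order_trans [OF _ zero_le_power2 [of a]] by (simp add: Pair gq_character_pair)
qed

theorem theorem17:
  fixes P :: gq_params and q :: gq
  assumes "invertible (gq_matrix P)"
  shows "(gq_ellipsoid P \<and> gq_unit P q \<longrightarrow> gq_rotation_on P UNIV (gq_sandwich P q)) \<and>
         (gq_indefinite P \<and> gq_unit P q \<and> gq_timelike P q \<longrightarrow>
            gq_rotation_on P {p. gq_unit P p \<and> gq_timelike P p} (gq_sandwich P q))"
proof -
  \<comment> \<open>Being unit only gives absolute value 1; definiteness or timelikeness supplies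
    the sign.\<close>
  have "gq_character P q = 1" if "gq_unit P q" "gq_character P q \<ge> 0"
    using that by (simp add: gq_unit_def gq_norm_def)
  then show ?thesis
    using gq_rotation_on_sandwich gq_character_nonneg_if_ellipsoid
    by (auto simp: gq_timelike_def)
qed

end
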